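(* Let $q\ge 5$ be an integer and let $a_n,b_n,c_n,d_n,e_n$ ($n\ge 0$) be the numbers of vertices of types $A,B,C,D,E$, respectively, on level $n$ of the Pascal pyramid $\mathcal{PP}_{4,q}$ in $\mathbf{H}^2\times\mathbf{R}$ (defined in the context). Then $a_1=b_1=c_1=d_1=e_1=0$ and for every $n\ge 1$: $$a_{n+1}=a_n+b_n+1,\quad b_{n+1}=(q-4)a_n+(q-3)b_n,\quad c_{n+1}=c_n+2,\quad d_{n+1}=a_n+d_n,\quad e_{n+1}=b_n+e_n.$$
   Context: Fix an integer $q\ge5$ and the regular tiling $\{4,q\}$ of the hyperbolic plane by congruent squares, $q$ squares meeting at each vertex; let $d$ be the edge length. Hyperbolic Pascal triangle $\mathcal{HPT}$ (a subgraph of the tiling), built row by row. Row $0$ is a single base vertex $V_0$. The leftmost and rightmost vertices of each row $j\ge1$ are called wingers; every other vertex of row $j\ge 2$ has type $A$ or $B$. From each vertex of row $j$ one draws, in order from left to right, its descending edges (tiling edges going away from $V_0$): $2$ from $V_0$ and from each winger, $q-2$ from each vertex of type $A$, $q-1$ from each vertex of type $B$. For two consecutive vertices of row $j$, the rightmost descending edge of the left one and the leftmost descending edge of the right one end at a common vertex of row $j+1$, which is of type $A$; the two outermost descending edges of row $j$ end at the two wingers of row $j+1$; all remaining descending edges end at distinct vertices of row $j+1$, which are of type $B$. (Thus row $n$ consists of the vertices at graph distance $n$ from $V_0$; a non-winger has type $A$ iff it has two neighbours in the previous row, type $B$ iff it has one.) Pascal pyramid $\mathcal{PP}_{4,q}$.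 Place $\mathcal{HPT}$ in the plane $\mathbf{H}^2\times\{0\}$ of $\mathbf{H}^2\times\mathbf{R}$ and copy it to the planes $\mathbf{H}^2\times\{kd\}$, $k=1,2,\dots$, with corresponding vertices on the same fibre $\{v\}\times\mathbf{R}$ (this is part of the tiling of $\mathbf{H}^2\times\mathbf{R}$ by square prisms over $\{4,q\}$ of height $d$). The vertices are the pairs $(v,k)$, $v$ a vertex of $\mathcal{HPT}$, $k\in\mathbb{Z}_{\ge0}$; edges join $(v,k)$–$(w,k)$ whenever $vw$ is an edge of $\mathcal{HPT}$, and $(v,k)$–$(v,k+1)$. Level $n$ is the set of vertices at edge-distance $n$ from $(V_0,0)$, i.e. of $(v,k)$ with $v$ in row $r$ of $\mathcal{HPT}$ and $r+k=n$. The value of a vertex is the number of shortest edge paths from $(V_0,0)$ to it. Vertex types on level $n\ge1$: type $1$: $(V_0,k)$ with $k\ge1$, and $(w,0)$ with $w$ a winger; type $A$ (resp. $B$): $(v,0)$ with $v$ of type $A$ (resp. $B$) in $\mathcal{HPT}$; type $C$: $(w,k)$ with $w$ a winger and $k\ge1$; type $D$ (resp. $E$): $(v,k)$ with $k\ge1$ and $v$ of type $A$ (resp. $B$) in $\mathcal{HPT}$. (The level-$0$ vertex $(V_0,0)$ has none of the types $A,\dots,E$.) *)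

theory Defs
  imports Main
begin

text \<open>
  The hyperbolic Pascal triangle. A vertex is a pair \<open>(j, i)\<close>: the vertex at position \<open>i\<close>
  (counted from the left, starting with 0) of row \<open>j\<close>.
\<close>

type_synonym hpt_vertex = "nat \<times> nat"

datatype hpt_type = Base | Winger | HA | HB

fun desc_deg :: "nat \<Rightarrow> hpt_type \<Rightarrow> nat" where
  "desc_deg q Base = 2"
| "desc_deg q Winger = 2"
| "desc_deg q HA = q - 2"
| "desc_deg q HB = q - 1"

text \<open>
  For a row whose vertices have types \<open>ts\<close>, \<open>desc_end q ts i e\<close> is the position in the next row
  of the end of the \<open>e\<close>-th descending edge (\<open>e < desc_deg q (ts ! i)\<close>) of the \<open>i\<close>-th vertex.
  The summands are \<open>desc_deg - 1\<close> because the last descending edge of a vertex and the first one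
  of its right neighbour have the same end; all other ends are distinct.
  Hence \<open>desc_end q ts (length ts) 0\<close> is the end of the last descending edge of the whole row.
\<close>

definition desc_end :: "nat \<Rightarrow> hpt_type list \<Rightarrow> nat \<Rightarrow> nat \<Rightarrow> nat" where
  "desc_end q ts i e = (\<Sum>l<i. (desc_deg q (ts ! l) - 1)) + e"

definition next_type :: "nat \<Rightarrow> hpt_type list \<Rightarrow> nat \<Rightarrow> hpt_type" where
  "next_type q ts p =
     (if p = 0 \<or> p = desc_end q ts (length ts) 0 then Winger
      else if \<exists>i\<in>{1..<length ts}. p = desc_end q ts i 0 then HA
      else HB)"

primrec hpt_row :: "nat \<Rightarrow> nat \<Rightarrow> hpt_type list" where
  "hpt_row q 0 = [Base]"
| "hpt_row q (Suc j) =
     (let ts = hpt_row q j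
      in map (next_type q ts) [0..<Suc (desc_end q ts (length ts) 0)])"

definition hpt_verts :: "nat \<Rightarrow> hpt_vertex set" where
  "hpt_verts q = {(j, i). i < length (hpt_row q j)}"

definition hpt_type_of :: "nat \<Rightarrow> hpt_vertex \<Rightarrow> hpt_type" where
  "hpt_type_of q v = hpt_row q (fst v) ! snd v"

definition hpt_desc_edges :: "nat \<Rightarrow> (hpt_vertex \<times> hpt_vertex) set" where
  "hpt_desc_edges q =
     {((j, i), (Suc j, desc_end q (hpt_row q j) i e)) | j i e.
        i < length (hpt_row q j) \<and> e < desc_deg q (hpt_row q j ! i)}"

definition hpt_edges :: "nat \<Rightarrow> (hpt_vertex \<times> hpt_vertex) set" where
  "hpt_edges q = hpt_desc_edges q \<union> (hpt_desc_edges q)\<inverse>"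

definition hpt_base :: hpt_vertex where
  "hpt_base = (0, 0)"

text \<open>
  The Pascal pyramid: \<open>(v, k)\<close> is the copy of the vertex \<open>v\<close> at height \<open>k d\<close>.
  Undirected edges are represented by symmetric relations.
\<close>

type_synonym pp_vertex = "hpt_vertex \<times> nat"

definition pp_verts :: "nat \<Rightarrow> pp_vertex set" where
  "pp_verts q = hpt_verts q \<times> UNIV"

definition pp_edges :: "nat \<Rightarrow> (pp_vertex \<times> pp_vertex) set" where
  "pp_edges q =
     {((v, k), (w, k)) | v w k. (v, w) \<in> hpt_edges q} \<union>
     {((v, k), (v, Suc k)) | v k. v \<in> hpt_verts q} \<union>
     {((v, Suc k), (v, k)) | v k. v \<in> hpt_verts q}"

definition pp_apex :: pp_vertex where
  "pp_apex = (hpt_base, 0)"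

definition edge_dist :: "('a \<times> 'a) set \<Rightarrow> 'a \<Rightarrow> 'a \<Rightarrow> nat" where
  "edge_dist E x y = (LEAST n. (x, y) \<in> E ^^ n)"

text \<open>The reachability condition is needed because \<open>LEAST\<close> is unspecified without a path.\<close>

definition pp_level :: "nat \<Rightarrow> nat \<Rightarrow> pp_vertex set" where
  "pp_level q n =
     {x \<in> pp_verts q. (pp_apex, x) \<in> (pp_edges q)\<^sup>* \<and> edge_dist (pp_edges q) pp_apex x = n}"

datatype pp_type = Type1 | TypeA | TypeB | TypeC | TypeD | TypeE

fun fibre_type :: "hpt_type \<Rightarrow> nat \<Rightarrow> pp_type option" where
  "fibre_type Base 0 = None"
| "fibre_type Base (Suc k) = Some Type1"
| "fibre_type Winger 0 = Some Type1"
| "fibre_type Winger (Suc k) = Some TypeC"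
| "fibre_type HA 0 = Some TypeA"
| "fibre_type HA (Suc k) = Some TypeD"
| "fibre_type HB 0 = Some TypeB"
| "fibre_type HB (Suc k) = Some TypeE"

definition pp_type_of :: "nat \<Rightarrow> pp_vertex \<Rightarrow> pp_type option" where
  "pp_type_of q x = fibre_type (hpt_type_of q (fst x)) (snd x)"

definition num_of_type :: "nat \<Rightarrow> pp_type \<Rightarrow> nat \<Rightarrow> nat" where
  "num_of_type q t n = card {x \<in> pp_level q n. pp_type_of q x = Some t}"

end

theory Submission
  imports Defs
begin

text \<open>
  Every edge of the pyramid changes \<open>j + k\<close> by exactly one at \<open>((j, i), k)\<close>, and every vertex other
  than the apex has a neighbour with smaller \<open>j + k\<close>; so level \<open>n\<close> is given by \<open>j + k = n\<close>. The
  types \<open>A\<close>, \<open>B\<close> are therefore counted by row \<open>n\<close> alone, and \<open>C\<close>, \<open>D\<close>, \<open>E\<close> by the rows below \<open>n\<close>.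
  In a row with \<open>m\<close> vertices, the \<open>m - 1\<close> merges of neighbouring outermost edges produce the \<open>A\<close>
  vertices of the next row, and the total number of descending edges determines its \<open>B\<close> vertices.
\<close>

section \<open>Rows of the hyperbolic Pascal triangle\<close>

declare hpt_row.simps(2) [simp del]

lemma desc_deg_ge_2: "2 \<le> desc_deg q T" if "4 \<le> q"
  using that by (cases T) auto

lemma desc_end_0 [simp]: "desc_end q ts 0 0 = 0"
  by (simp add: desc_end_def)

text \<open>Every type has at least two descending edges, so each summand is positive. Past the end
  of \<open>ts\<close> the value \<open>ts ! i\<close> is still some type, so this holds on all of
  \<open>nat\<close>.\<close>

lemma strict_mono_desc_end:
  assumes "4 \<le> q"
  shows "strict_mono (\<lambda>i. desc_end q ts i 0)"
proof (rule strict_mono_Suc_iff[THEN iffD2], intro allI)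
  fix i
  show "desc_end q ts i 0 < desc_end q ts (Suc i) 0"
    using desc_deg_ge_2[OF assms, of "ts ! i"] by (simp add: desc_end_def)
qed

text \<open>The ends below one vertex form an interval that shares its last position with the next
  interval, so no position is missed. This gives every vertex a parent in the row above.\<close>

lemma desc_end_surj:
  assumes "4 \<le> q" "0 < m" "p \<le> desc_end q ts m 0"
  shows "\<exists>i<m. \<exists>e<desc_deg q (ts ! i). p = desc_end q ts i e"
  using assms(2,3)
proof (induction m)
  case (Suc m)
  show ?case
  \<comment> \<open>The induction hypothesis says nothing for \<open>m = 0\<close>; a single vertex
    therefore falls under the second case, where vertex \<open>m\<close> itself is the
    parent.\<close>
  proof (cases "0 < m \<and> p \<le> desc_end q ts m 0")
    case True
    then show ?thesis using Suc.IH less_Suc_eq by blast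
  next
    case False
    let ?e = "p - desc_end q ts m 0"
    have "desc_end q ts m 0 \<le> p" using False by (cases "m = 0") auto
    then have "p = desc_end q ts m ?e" by (simp add: desc_end_def)
    moreover have "?e < desc_deg q (ts ! m)"
      using Suc.prems desc_deg_ge_2[OF assms(1), of "ts ! m"] by (simp add: desc_end_def)
    ultimately show ?thesis by blast
  qed
qed simp

lemma sum_list_hpt_type:
  fixes f :: "hpt_type \<Rightarrow> nat"
  shows "sum_list (map f ts) = count_list ts Base * f Base + count_list ts Winger * f Winger
    + count_list ts HA * f HA + count_list ts HB * f HB"
proof (induction ts)
  case (Cons T ts)
  then show ?case by (cases T) auto
qed simp

lemma length_hpt_type:
  "length ts = count_list ts Base + count_list ts Winger + count_list ts HA + count_list ts HB"
  using sum_list_hpt_type[of "\<lambda>_. 1" ts] by (simp add: sum_list_triv)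

lemma count_list_conv_card: "count_list xs x = card {i. i < length xs \<and> xs ! i = x}"
  by (simp add: count_list_eq_length_filter length_filter_conv_card eq_commute)

lemma count_list_map_upt: "count_list (map f [0..<n]) x = card {p. p < n \<and> f p = x}"
  by (simp add: count_list_conv_card cong: conj_cong)

lemma length_hpt_row_Suc:
  "length (hpt_row q (Suc j)) = Suc (desc_end q (hpt_row q j) (length (hpt_row q j)) 0)"
  by (simp add: hpt_row.simps(2) Let_def)

lemma hpt_row_nonempty: "0 < length (hpt_row q j)"
  by (cases j) (simp_all add: length_hpt_row_Suc)

lemma count_hpt_row_Suc:
  "count_list (hpt_row q (Suc j)) T = card {p.
     p \<le> desc_end q (hpt_row q j) (length (hpt_row q j)) 0 \<and> next_type q (hpt_row q j) p = T}"
  by (simp only: hpt_row.simps Let_def count_list_map_upt less_Suc_eq_le)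

lemma count_Base_Suc: "count_list (hpt_row q (Suc j)) Base = 0"
  unfolding count_hpt_row_Suc by (simp add: next_type_def)

lemma count_Winger_Suc:
  assumes "4 \<le> q"
  shows "count_list (hpt_row q (Suc j)) Winger = 2"
proof -
  let ?S = "desc_end q (hpt_row q j) (length (hpt_row q j)) 0"
  \<comment> \<open>This keeps the two winger positions apart, so that there are two of
    them.\<close>
  have "0 < ?S"
    using strict_mono_less[OF strict_mono_desc_end[OF assms], of _ 0] hpt_row_nonempty by simp
  moreover have "{p. p \<le> ?S \<and> next_type q (hpt_row q j) p = Winger} = {0, ?S}"
    by (auto simp: next_type_def)
  ultimately show ?thesis
    unfolding count_hpt_row_Suc by simp
qed

text \<open>Strict monotonicity makes the merge positions distinct and keeps them strictly between
  the two wingers, which \<open>next_type\<close> tests first.\<close>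

lemma count_HA_Suc:
  assumes "4 \<le> q"
  shows "count_list (hpt_row q (Suc j)) HA = length (hpt_row q j) - 1"
proof -
  let ?ts = "hpt_row q j"
  let ?m = "length ?ts"
  let ?f = "\<lambda>i. desc_end q ?ts i 0"
  have mono: "?f i < ?f k \<longleftrightarrow> i < k" for i k
    by (rule strict_mono_less[OF strict_mono_desc_end[OF assms]])
  have "0 < ?f i \<and> ?f i < ?f ?m" if "i \<in> {1..<?m}" for i
    using mono[of 0 i] mono[of i ?m] that by simp
  then have inner: "?f ` {1..<?m} \<subseteq> {0<..<?f ?m}" by auto
  have "next_type q ?ts p = HA \<longleftrightarrow> p \<noteq> 0 \<and> p \<noteq> ?f ?m \<and> p \<in> ?f ` {1..<?m}" for p
    by (auto simp: next_type_def)
  with inner have "{p. p \<le> ?f ?m \<and> next_type q ?ts p = HA} = ?f ` {1..<?m}" by auto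
  moreover have "inj_on ?f {1..<?m}"
    using strict_mono_on_imp_inj_on[OF strict_mono_desc_end[OF assms]]
    by (rule inj_on_subset) simp
  ultimately show ?thesis
    unfolding count_hpt_row_Suc by (simp add: card_image)
qed

text \<open>The \<open>HB\<close> vertices are what remains of the new row after removing wingers
  and \<open>HA\<close> vertices. For \<open>1 \<le> j\<close> the old row has no base and two
  wingers, each adding 1 to the width.\<close>

lemma count_HB_Suc:
  assumes "4 \<le> q" "1 \<le> j"
  shows "count_list (hpt_row q (Suc j)) HB =
    (q - 4) * count_list (hpt_row q j) HA + (q - 3) * count_list (hpt_row q j) HB"
proof -
  let ?ts = "hpt_row q j"
  obtain j' where j: "j = Suc j'" using assms(2) by (cases j) auto
  have row: "count_list ?ts Base = 0" "count_list ?ts Winger = 2"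
    unfolding j by (simp_all only: count_Base_Suc count_Winger_Suc[OF assms(1)])
  \<comment> \<open>Writing \<open>q\<close> as \<open>r + 4\<close> removes the truncated
    subtractions.\<close>
  obtain r where r: "q = r + 4" using assms(1) by (metis add.commute le_Suc_ex)
  have "desc_end q ?ts (length ?ts) 0 = sum_list (map (\<lambda>T. desc_deg q T - 1) ?ts)"
    by (simp add: desc_end_def sum_list_sum_nth atLeast0LessThan)
  also have "\<dots> = 2 + (r + 1) * count_list ?ts HA + (r + 2) * count_list ?ts HB"
    using row unfolding r by (simp add: sum_list_hpt_type algebra_simps)
  finally have S: "desc_end q ?ts (length ?ts) 0 = \<dots>" .
  have "Suc (desc_end q ?ts (length ?ts) 0) =
      2 + (length ?ts - 1) + count_list (hpt_row q (Suc j)) HB"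
    using length_hpt_type[of "hpt_row q (Suc j)"]
    unfolding length_hpt_row_Suc count_Base_Suc count_Winger_Suc[OF assms(1)]
      count_HA_Suc[OF assms(1)] by simp
  moreover have "length ?ts = 2 + count_list ?ts HA + count_list ?ts HB"
    using length_hpt_type[of ?ts] row by simp
  ultimately have "count_list (hpt_row q (Suc j)) HB =
      r * count_list ?ts HA + (r + 1) * count_list ?ts HB"
    unfolding S by (simp add: algebra_simps)
  then show ?thesis by (simp add: r)
qed

section \<open>Levels of the pyramid\<close>

text \<open>A one-sided bound suffices: it bounds path lengths from below, and explicit paths attain
  that bound.\<close>

lemma pp_edges_rank:
  assumes "(x, y) \<in> pp_edges q"
  shows "fst (fst y) + snd y \<le> Suc (fst (fst x) + snd x)"
  using assms by (auto simp: pp_edges_def hpt_edges_def hpt_desc_edges_def)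

lemma pp_path_rank:
  assumes "(pp_apex, x) \<in> pp_edges q ^^ n"
  shows "fst (fst x) + snd x \<le> n"
  using assms
proof (induction n arbitrary: x)
  case 0
  then show ?case by (auto simp: pp_apex_def hpt_base_def)
next
  case (Suc n)
  then obtain y where "(pp_apex, y) \<in> pp_edges q ^^ n" "(y, x) \<in> pp_edges q" by auto
  then show ?case using Suc.IH pp_edges_rank by fastforce
qed

lemma pp_path_row:
  assumes "4 \<le> q" "i < length (hpt_row q j)"
  shows "(pp_apex, ((j, i), 0)) \<in> pp_edges q ^^ j"
  using assms(2)
proof (induction j arbitrary: i)
  case 0
  then show ?case by (simp add: pp_apex_def hpt_base_def)
next
  case (Suc j)
  have "i \<le> desc_end q (hpt_row q j) (length (hpt_row q j)) 0"
    using Suc.prems unfolding length_hpt_row_Suc by simp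
  then obtain l e where l: "l < length (hpt_row q j)" "e < desc_deg q (hpt_row q j ! l)"
      "i = desc_end q (hpt_row q j) l e"
    using desc_end_surj[OF assms(1) hpt_row_nonempty] by blast
  then have "((j, l), (Suc j, i)) \<in> hpt_desc_edges q"
    unfolding hpt_desc_edges_def by blast
  then have "(((j, l), 0), ((Suc j, i), 0)) \<in> pp_edges q"
    by (simp add: pp_edges_def hpt_edges_def)
  then show ?case using Suc.IH[OF l(1)] by auto
qed

lemma pp_path:
  assumes "4 \<le> q" "i < length (hpt_row q j)"
  shows "(pp_apex, ((j, i), k)) \<in> pp_edges q ^^ (j + k)"
proof (induction k)
  case 0
  then show ?case using pp_path_row[OF assms] by simp
next
  case (Suc k)
  have "(((j, i), k), ((j, i), Suc k)) \<in> pp_edges q"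
    using assms(2) by (simp add: pp_edges_def hpt_verts_def)
  then show ?case using Suc by auto
qed

lemma pp_level_eq:
  assumes "4 \<le> q"
  shows "pp_level q n = {((j, i), k) | j i k. j + k = n \<and> i < length (hpt_row q j)}"
proof -
  have dist: "edge_dist (pp_edges q) pp_apex ((j, i), k) = j + k"
    if "i < length (hpt_row q j)" for j i k
    unfolding edge_dist_def
  proof (rule Least_equality)
    show "(pp_apex, ((j, i), k)) \<in> pp_edges q ^^ (j + k)" by (rule pp_path[OF assms that])
    show "j + k \<le> n" if "(pp_apex, ((j, i), k)) \<in> pp_edges q ^^ n" for n
      using pp_path_rank[OF that] by simp
  qed
  have "(pp_apex, ((j, i), k)) \<in> (pp_edges q)\<^sup>*" if "i < length (hpt_row q j)" for j i k
    using pp_path[OF assms that] by (rule relpow_imp_rtrancl)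
  then show ?thesis
    by (auto simp: pp_level_def pp_verts_def hpt_verts_def dist)
qed

lemma num_of_type_bottom:
  assumes "4 \<le> q" and t: "\<And>S k. fibre_type S k = Some t \<longleftrightarrow> S = T \<and> k = 0"
  shows "num_of_type q t n = count_list (hpt_row q n) T"
proof -
  have "{x \<in> pp_level q n. pp_type_of q x = Some t} =
      (\<lambda>i. ((n, i), 0)) ` {i. i < length (hpt_row q n) \<and> hpt_row q n ! i = T}"
    by (auto simp: pp_level_eq[OF assms(1)] pp_type_of_def hpt_type_of_def t)
  then show ?thesis
    by (simp add: num_of_type_def count_list_conv_card card_image inj_on_def)
qed

text \<open>On level \<open>n\<close> the height over row \<open>j\<close> is forced to be
  \<open>n - j\<close>, and it is positive exactly for \<open>j < n\<close>. Hence projecting to the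
  triangle loses nothing.\<close>

lemma num_of_type_above:
  assumes "4 \<le> q" and t: "\<And>S k. fibre_type S k = Some t \<longleftrightarrow> S = T \<and> 0 < k"
  shows "num_of_type q t n = (\<Sum>j<n. count_list (hpt_row q j) T)"
proof -
  let ?P = "\<lambda>j. {i. i < length (hpt_row q j) \<and> hpt_row q j ! i = T}"
  have "{x \<in> pp_level q n. pp_type_of q x = Some t} =
      (\<lambda>v. (v, n - fst v)) ` (SIGMA j:{..<n}. ?P j)"
    by (force simp: pp_level_eq[OF assms(1)] pp_type_of_def hpt_type_of_def t image_iff)
  moreover have "inj_on (\<lambda>v. (v, n - fst v)) X" for X :: "hpt_vertex set"
    by (simp add: inj_on_def)
  ultimately show ?thesis
    by (simp add: num_of_type_def count_list_conv_card card_image)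
qed

theorem theorem1:
  fixes q :: nat and a b c d e :: "nat \<Rightarrow> nat"
  assumes "q \<ge> 5"
  defines "a \<equiv> num_of_type q TypeA"
    and "b \<equiv> num_of_type q TypeB"
    and "c \<equiv> num_of_type q TypeC"
    and "d \<equiv> num_of_type q TypeD"
    and "e \<equiv> num_of_type q TypeE"
  shows "a 1 = 0 \<and> b 1 = 0 \<and> c 1 = 0 \<and> d 1 = 0 \<and> e 1 = 0 \<and>
    (\<forall>n\<ge>1. a (n + 1) = a n + b n + 1 \<and>
           b (n + 1) = (q - 4) * a n + (q - 3) * b n \<and>
           c (n + 1) = c n + 2 \<and>
           d (n + 1) = a n + d n \<and>
           e (n + 1) = b n + e n)"
proof -
  have q: "4 \<le> q" using assms(1) by simp
  have fibre: "fibre_type S k = Some TypeA \<longleftrightarrow> S = HA \<and> k = 0"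
    "fibre_type S k = Some TypeB \<longleftrightarrow> S = HB \<and> k = 0"
    "fibre_type S k = Some TypeC \<longleftrightarrow> S = Winger \<and> 0 < k"
    "fibre_type S k = Some TypeD \<longleftrightarrow> S = HA \<and> 0 < k"
    "fibre_type S k = Some TypeE \<longleftrightarrow> S = HB \<and> 0 < k" for S k
    by (cases S; cases k; simp)+
  have a: "a n = count_list (hpt_row q n) HA" and b: "b n = count_list (hpt_row q n) HB"
    and c: "c n = (\<Sum>j<n. count_list (hpt_row q j) Winger)"
    and d: "d n = (\<Sum>j<n. count_list (hpt_row q j) HA)"
    and e: "e n = (\<Sum>j<n. count_list (hpt_row q j) HB)" for n
    unfolding a_def b_def c_def d_def e_def
    by (rule num_of_type_bottom[OF q fibre(1)] num_of_type_bottom[OF q fibre(2)]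
        num_of_type_above[OF q fibre(3)] num_of_type_above[OF q fibre(4)]
        num_of_type_above[OF q fibre(5)])+
  have "a 1 = 0" using count_HA_Suc[OF q, of 0] by (simp add: a)
  \<comment> \<open>Row 1 has length 2 and both its vertices are wingers.\<close>
  moreover have "b 1 = 0"
    using length_hpt_type[of "hpt_row q (Suc 0)"] count_Winger_Suc[OF q, of 0]
    unfolding length_hpt_row_Suc by (simp add: b desc_end_def)
  moreover have "c 1 = 0" "d 1 = 0" "e 1 = 0" by (simp_all add: c d e)
  moreover have "a (n + 1) = a n + b n + 1 \<and> b (n + 1) = (q - 4) * a n + (q - 3) * b n \<and>
      c (n + 1) = c n + 2 \<and> d (n + 1) = a n + d n \<and> e (n + 1) = b n + e n" if "1 \<le> n" for n
  proof -
    obtain m where n: "n = Suc m" using \<open>1 \<le> n\<close> by (cases n) auto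
    have row: "count_list (hpt_row q n) Base = 0" "count_list (hpt_row q n) Winger = 2"
      unfolding n by (simp_all only: count_Base_Suc count_Winger_Suc[OF q])
    \<comment> \<open>The increments of \<open>c\<close>, \<open>d\<close>, \<open>e\<close> are the
      summand of row \<open>n\<close>; for \<open>a\<close>, the length of row \<open>n\<close> is
      \<open>2 + a n + b n\<close>.\<close>
    then show ?thesis
      using count_HA_Suc[OF q, of n] count_HB_Suc[OF q that] length_hpt_type[of "hpt_row q n"]
      by (simp add: a b c d e)
  qed
  ultimately show ?thesis by blast
qed

end
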